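(* Let $f\in C([0,1]^5)$, let $$F(t,x(\cdot),y(\cdot))=\iint_{\Delta_2} f(t,z_1,z_2,x(z_1),y(z_2))\,dz_1\,dz_2,\qquad \Delta_2=\{(z_1,z_2): z_1\ge0,\ z_2\ge0,\ z_1+z_2\le1\},$$ be the corresponding Urison operator, considered on the set $\Phi$ of pairs $(x,y)$ with $x,y\in C[0,1]$, $x(z_1)\ge 0$, $y(z_2)\ge 0$ and $x(z_1)+y(z_2)\le1$ for all $(z_1,z_2)\in\Delta_2$. Let $\alpha\ge0$. Then for every $m\ge1$, $t\in[0,1]$ and $(x,y)\in\Phi$, $$\left|F(t,x(\cdot),y(\cdot))-P_m^{[\alpha]}(F,x(\cdot),y(\cdot))\right|\le 2\,\omega\left(\sqrt{\frac{1+\alpha m}{m+\alpha m}}\right).$$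
   Context: For $m\ge1$, a parameter $\alpha\ge 0$ (which may depend only on $m$), $t\in[0,1]$ and $(x,y)\in\Phi$, the operator polynomial is $$P_m^{[\alpha]}(F,x(\cdot),y(\cdot))=\iint_{\Delta_2}\sum_{i,j\ge 0,\ i+j\le m} \frac{m!}{i!\,j!\,(m-i-j)!}\, v_m^{(i,j)}(x(z_1),y(z_2),\alpha)\, f\left(t,z_1,z_2,\frac im,\frac jm\right)dz_1\,dz_2,$$ where $$v_m^{(i,j)}(x,y,\alpha)=\frac{\prod_{k_1=0}^{i-1}(x+k_1\alpha)\,\prod_{k_2=0}^{j-1}(y+k_2\alpha)\,\prod_{k_3=0}^{m-i-j-1}(1-x-y+k_3\alpha)}{\prod_{k_4=0}^{m-1}(1+k_4\alpha)},$$ and empty products equal $1$. The modulus of continuity of $f$ in its last two variables is, for $\delta>0$, $$\omega(\delta)=\max_{t,z_1,z_2\in[0,1]}\ \sup_{|x'-x''|+|y'-y''|\le\delta}|f(t,z_1,z_2,x'',y'')-f(t,z_1,z_2,x',y')|,$$ the supremum being over $(x',y'),(x'',y'')\in[0,1]^2$. *)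

theory Defs
  imports "HOL-Analysis.Analysis"
begin

definition simplex2 :: "(real \<times> real) set" where
  "simplex2 = {(z1, z2). z1 \<ge> 0 \<and> z2 \<ge> 0 \<and> z1 + z2 \<le> 1}"

(* C[0,1] consists of the functions on the whole line that are continuous on {0..1};
   their values outside {0..1} are irrelevant. *)
definition admissible_pairs :: "((real \<Rightarrow> real) \<times> (real \<Rightarrow> real)) set" where
  "admissible_pairs =
     {(x, y). continuous_on {0..1} x \<and> continuous_on {0..1} y \<and>
        (\<forall>(z1, z2) \<in> simplex2. x z1 \<ge> 0 \<and> y z2 \<ge> 0 \<and> x z1 + y z2 \<le> 1)}"

definition urison ::
  "(real \<times> real \<times> real \<times> real \<times> real \<Rightarrow> real) \<Rightarrow> real \<Rightarrow> (real \<Rightarrow> real) \<Rightarrow> (real \<Rightarrow> real) \<Rightarrow> real" where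
  "urison f t x y = integral simplex2 (\<lambda>(z1, z2). f (t, z1, z2, x z1, y z2))"

(* Only used for i + j \<le> m, so the subtraction on nat does not truncate. *)
definition stancu_weight :: "nat \<Rightarrow> nat \<Rightarrow> nat \<Rightarrow> real \<Rightarrow> real \<Rightarrow> real \<Rightarrow> real" where
  "stancu_weight m i j x y \<alpha> =
     (\<Prod>k<i. x + real k * \<alpha>) * (\<Prod>k<j. y + real k * \<alpha>) *
     (\<Prod>k<m - i - j. 1 - x - y + real k * \<alpha>) / (\<Prod>k<m. 1 + real k * \<alpha>)"

(* The operator polynomial is built from the kernel f of the Urison operator, hence takes
   f rather than the operator as its argument. *)
definition operator_polynomial ::
  "nat \<Rightarrow> real \<Rightarrow> (real \<times> real \<times> real \<times> real \<times> real \<Rightarrow> real) \<Rightarrow> real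
     \<Rightarrow> (real \<Rightarrow> real) \<Rightarrow> (real \<Rightarrow> real) \<Rightarrow> real" where
  "operator_polynomial m \<alpha> f t x y =
     integral simplex2 (\<lambda>(z1, z2).
       \<Sum>(i, j) \<in> {(i, j). i + j \<le> m}.
         fact m / (fact i * fact j * fact (m - i - j)) *
         stancu_weight m i j (x z1) (y z2) \<alpha> *
         f (t, z1, z2, real i / real m, real j / real m))"

(* For f continuous on the unit cube the suprema are over nonempty bounded sets and the
   outer one is attained, so it is the maximum. *)
definition kernel_modulus ::
  "(real \<times> real \<times> real \<times> real \<times> real \<Rightarrow> real) \<Rightarrow> real \<Rightarrow> real" where
  "kernel_modulus f \<delta> =
     (SUP (t, z1, z2) \<in> {0..1} \<times> {0..1} \<times> {0..1}.
        SUP ((x', y'), (x'', y'')) \<in>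
          {((x', y'), (x'', y'')). (x', y') \<in> {0..1} \<times> {0..1} \<and> (x'', y'') \<in> {0..1} \<times> {0..1} \<and>
             \<bar>x' - x''\<bar> + \<bar>y' - y''\<bar> \<le> \<delta>}.
          \<bar>f (t, z1, z2, x'', y'') - f (t, z1, z2, x', y')\<bar>)"

end

theory Submission
  imports Defs
begin

text \<open>
  The coefficients \<open>m! / (i! j! (m - i - j)!) * v\<^sub>m\<^sup>(\<^sup>i\<^sup>,\<^sup>j\<^sup>)(a, b, \<alpha>)\<close> of the operator polynomial are
  probabilities. They give the distribution of the numbers \<open>i\<close>, \<open>j\<close> of balls of the first and
  the second colour in \<open>m\<close> draws from a Polya urn that starts with the masses \<open>a\<close>, \<open>b\<close>,
  \<open>1 - a - b\<close> of three colours and in which the mass of the drawn colour grows by \<open>\<alpha>\<close> after each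
  draw. So the integrand of the operator polynomial is the expectation of
  \<open>f (t, z\<^sub>1, z\<^sub>2, i/m, j/m)\<close> with \<open>a = x z\<^sub>1\<close> and \<open>b = y z\<^sub>2\<close>. The frequencies \<open>i/m\<close> and \<open>j/m\<close> have
  means \<open>a\<close> and \<open>b\<close> and, by \<open>polya_dispersion\<close>, variances \<open>a (1 - a) \<delta>\<^sup>2\<close> and \<open>b (1 - b) \<delta>\<^sup>2\<close>, where
  \<open>\<delta>\<^sup>2 = (1 + \<alpha> m) / (m + \<alpha> m)\<close>. This is why \<open>\<delta>\<close> is the right scale.

  The rest is the classical argument for Bernstein-type operators. A function whose oscillation
  at distance \<open>\<delta>\<close> is at most \<open>w\<close> changes by at most \<open>(1 + (s/\<delta>)\<^sup>2) w\<close> over a distance \<open>s\<close>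
  (\<open>modulus_of_continuity_subdivide\<close>). Here \<open>s = |i/m - a| + |j/m - b|\<close>, and \<open>s\<^sup>2\<close> is at most
  twice the sum of the squared deviations, so its expectation is at most
  \<open>2 (1/4 + 1/4) \<delta>\<^sup>2 = \<delta>\<^sup>2\<close>. The two integrands therefore differ by at most \<open>2 w\<close> at every point
  (\<open>bivariate_stancu_error\<close>), and integrating over the simplex, which lies in the unit square,
  preserves this bound. The remaining work is to see that both integrands are continuous on the
  simplex, so that the integrals may be subtracted.
\<close>

section \<open>Rising factorials with step \<open>\<alpha>\<close>\<close>

definition rising :: "real \<Rightarrow> real \<Rightarrow> nat \<Rightarrow> real" where
  "rising \<alpha> a n = (\<Prod>k<n. a + real k * \<alpha>)"

lemma rising_0 [simp]: "rising \<alpha> a 0 = 1"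
  by (simp add: rising_def)

lemma rising_Suc: "rising \<alpha> a (Suc n) = a * rising \<alpha> (a + \<alpha>) n"
  by (simp add: rising_def prod.lessThan_Suc_shift algebra_simps del: prod.lessThan_Suc)

lemma rising_nonneg: "\<alpha> \<ge> 0 \<Longrightarrow> a \<ge> 0 \<Longrightarrow> rising \<alpha> a n \<ge> 0"
  by (auto simp: rising_def intro!: prod_nonneg)

lemma rising_pos: "\<alpha> \<ge> 0 \<Longrightarrow> a > 0 \<Longrightarrow> rising \<alpha> a n > 0"
  by (auto simp: rising_def intro!: prod_pos add_pos_nonneg)

lemma rising_step_zero: "rising 0 a n = a ^ n"
  by (simp add: rising_def)

lemma rising_eq_pochhammer:
  assumes "\<alpha> \<noteq> 0"
  shows "rising \<alpha> a n = \<alpha> ^ n * pochhammer (a / \<alpha>) n"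
proof -
  have "rising \<alpha> a n = (\<Prod>k<n. \<alpha> * (a / \<alpha> + real k))"
    unfolding rising_def using assms by (intro prod.cong) (auto simp: field_simps)
  then show ?thesis
    by (simp add: prod.distrib pochhammer_prod atLeast0LessThan)
qed

text \<open>
  For \<open>\<alpha> = 0\<close> this is the binomial theorem; for \<open>\<alpha> \<noteq> 0\<close> rescaling by \<open>\<alpha>\<close> reduces it to the
  Chu--Vandermonde identity for Pochhammer symbols. It is what makes the urn weights add up
  to 1, and also what allows two colours to be merged into one.
\<close>

lemma rising_vandermonde:
  "(\<Sum>i\<le>n. real (n choose i) * rising \<alpha> a i * rising \<alpha> b (n - i)) = rising \<alpha> (a + b) n"
proof (cases "\<alpha> = 0")
  case True
  then show ?thesis
    by (simp add: rising_step_zero binomial_ring)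
next
  case False
  have "(\<Sum>i\<le>n. real (n choose i) * rising \<alpha> a i * rising \<alpha> b (n - i))
      = (\<Sum>i\<le>n. \<alpha> ^ n * (real (n choose i) * pochhammer (a / \<alpha>) i * pochhammer (b / \<alpha>) (n - i)))"
    by (intro sum.cong)
       (auto simp: rising_eq_pochhammer[OF False] simp flip: power_add)
  also have "\<dots> = rising \<alpha> (a + b) n"
    by (simp add: rising_eq_pochhammer[OF False] add_divide_distrib
          pochhammer_binomial_sum sum_distrib_left)
  finally show ?thesis .
qed

section \<open>Moments of the one-colour marginal\<close>

text \<open>
  The tool for factorial moments: a factor \<open>i\<close> is absorbed into the binomial coefficient, and the
  first factor of the rising factorial is split off, so that the same kind of sum remains with \<open>n\<close>
  draws and with \<open>a + \<alpha>\<close> in place of \<open>a\<close>. In terms of the urn, this conditions on the first ball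
  having the first colour.
\<close>

lemma rising_sum_absorb:
  "(\<Sum>i\<le>Suc n. real (Suc n choose i) * rising \<alpha> a i * rising \<alpha> b (Suc n - i) * (real i * \<psi> i))
    = real (Suc n) * a *
      (\<Sum>i\<le>n. real (n choose i) * rising \<alpha> (a + \<alpha>) i * rising \<alpha> b (n - i) * \<psi> (Suc i))"
proof -
  have absorb: "real (Suc n choose Suc i) * real (Suc i) = real (Suc n) * real (n choose i)" for i
    using Suc_times_binomial_eq[of n i]
    by (metis of_nat_mult)
  have "(\<Sum>i\<le>Suc n. real (Suc n choose i) * rising \<alpha> a i * rising \<alpha> b (Suc n - i) * (real i * \<psi> i))
      = (\<Sum>i\<le>n. (real (Suc n choose Suc i) * real (Suc i)) *
            (rising \<alpha> a (Suc i) * rising \<alpha> b (n - i) * \<psi> (Suc i)))"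
    by (subst sum.atMost_Suc_shift) (simp add: mult_ac del: binomial_Suc_Suc of_nat_Suc)
  also have "\<dots> = (\<Sum>i\<le>n. real (Suc n) * a *
      (real (n choose i) * rising \<alpha> (a + \<alpha>) i * rising \<alpha> b (n - i) * \<psi> (Suc i)))"
    unfolding absorb rising_Suc by (simp add: mult_ac del: of_nat_Suc)
  finally show ?thesis
    by (simp add: sum_distrib_left)
qed

lemma rising_first_moment:
  "(\<Sum>i\<le>Suc n. real (Suc n choose i) * rising \<alpha> a i * rising \<alpha> b (Suc n - i) * real i)
    = real (Suc n) * a * rising \<alpha> (a + b + \<alpha>) n"
  using rising_sum_absorb[of n \<alpha> a b "\<lambda>_. 1"] rising_vandermonde[of n \<alpha> "a + \<alpha>" b]
  by (simp add: add_ac)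

text \<open>
  Absorption with \<open>\<psi> i = i - 1\<close> leaves a first moment. For \<open>m \<le> 1\<close> the truncated \<open>m - 2\<close> is
  harmless, since the factor \<open>m (m - 1)\<close> vanishes.
\<close>

lemma rising_second_factorial_moment:
  "(\<Sum>i\<le>m. real (m choose i) * rising \<alpha> a i * rising \<alpha> b (m - i) * (real i * (real i - 1)))
    = real m * (real m - 1) * a * (a + \<alpha>) * rising \<alpha> (a + b + 2 * \<alpha>) (m - 2)"
proof (cases m)
  case 0
  then show ?thesis by simp
next
  case (Suc n)
  have step: "(\<Sum>i\<le>m. real (m choose i) * rising \<alpha> a i * rising \<alpha> b (m - i) * (real i * (real i - 1)))
      = real m * a * (\<Sum>i\<le>n. real (n choose i) * rising \<alpha> (a + \<alpha>) i * rising \<alpha> b (n - i) * real i)"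
    using rising_sum_absorb[of n \<alpha> a b "\<lambda>i. real i - 1"] Suc by simp
  show ?thesis
  proof (cases n)
    case 0
    then show ?thesis
      using Suc by simp
  next
    case (Suc n')
    show ?thesis
      unfolding step using rising_first_moment[of n' \<alpha> "a + \<alpha>" b] Suc \<open>m = Suc n\<close>
      by (simp add: algebra_simps)
  qed
qed

text \<open>
  The square expands into \<open>i (i - 1)\<close>, \<open>i\<close> and \<open>1\<close>, and the moments above apply with total mass
  \<open>a + (1 - a) = 1\<close>. Since \<open>rising \<alpha> 1 m\<close> is the normalising constant of the distribution, the
  right-hand side is the variance times that constant. At \<open>\<alpha> = 0\<close> the variance is the binomial
  \<open>a (1 - a) / m\<close>; reinforcement enlarges it by \<open>(1 + \<alpha> m) / (1 + \<alpha>)\<close>.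
\<close>

lemma polya_variance:
  assumes "\<alpha> \<ge> 0" and "m \<ge> 1"
  shows "(\<Sum>i\<le>m. real (m choose i) * rising \<alpha> a i * rising \<alpha> (1 - a) (m - i) * (real i / real m - a)\<^sup>2)
    = a * (1 - a) * ((1 + \<alpha> * real m) / (real m + \<alpha> * real m)) * rising \<alpha> 1 m"
proof -
  define w where "w = (\<lambda>i. real (m choose i) * rising \<alpha> a i * rising \<alpha> (1 - a) (m - i))"
  define R where "R = rising \<alpha> 1 m"
  obtain n where n: "m = Suc n" using assms by (cases m) auto
  have m0: "(\<Sum>i\<le>m. w i) = R"
    using rising_vandermonde[of m \<alpha> a "1 - a"] by (simp add: w_def R_def)
  have m1: "(\<Sum>i\<le>m. w i * real i) = real m * a * R"
    using rising_first_moment[of n \<alpha> a "1 - a"] n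
    by (simp add: w_def R_def rising_Suc[of \<alpha> 1])
  have m2: "(1 + \<alpha>) * (\<Sum>i\<le>m. w i * (real i * (real i - 1)))
      = real m * (real m - 1) * a * (a + \<alpha>) * R"
  proof (cases n)
    case 0
    then show ?thesis using n by simp
  next
    case (Suc n')
    have "R = (1 + \<alpha>) * rising \<alpha> (1 + 2 * \<alpha>) n'"
      by (simp add: R_def n Suc rising_Suc[of \<alpha> 1] rising_Suc[of \<alpha> "1 + \<alpha>"] add.assoc)
    then show ?thesis
      using rising_second_factorial_moment[of m \<alpha> a "1 - a"] n Suc
      by (simp add: w_def mult_ac)
  qed
  have "(\<Sum>i\<le>m. w i * (real i / real m - a)\<^sup>2)
      = (\<Sum>i\<le>m. w i * (real i * (real i - 1)) / (real m)\<^sup>2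
          + (1 / (real m)\<^sup>2 - 2 * a / real m) * (w i * real i) + a\<^sup>2 * w i)"
    using assms by (intro sum.cong) (auto simp: field_simps power2_eq_square)
  also have "\<dots> = (\<Sum>i\<le>m. w i * (real i * (real i - 1))) / (real m)\<^sup>2
      + (1 / (real m)\<^sup>2 - 2 * a / real m) * (real m * a * R) + a\<^sup>2 * R"
    by (simp only: sum.distrib m0 m1 flip: sum_distrib_left sum_divide_distrib)
  also have "(\<Sum>i\<le>m. w i * (real i * (real i - 1)))
      = real m * (real m - 1) * a * (a + \<alpha>) * R / (1 + \<alpha>)"
    using m2 assms by (simp add: field_simps)
  also have "real m * (real m - 1) * a * (a + \<alpha>) * R / (1 + \<alpha>) / (real m)\<^sup>2
      + (1 / (real m)\<^sup>2 - 2 * a / real m) * (real m * a * R) + a\<^sup>2 * R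
      = a * (1 - a) * ((1 + \<alpha> * real m) / (real m + \<alpha> * real m)) * R"
  proof -
    let ?D = "real m + \<alpha> * real m"
    have pos: "real m > 0" "1 + \<alpha> > 0" using assms by auto
    have D: "?D = (1 + \<alpha>) * real m" by (simp add: algebra_simps)
    have "real m * (real m - 1) * a * (a + \<alpha>) * R / (1 + \<alpha>) / (real m)\<^sup>2
        = (real m - 1) * a * (a + \<alpha>) * R / ?D"
      "(1 / (real m)\<^sup>2 - 2 * a / real m) * (real m * a * R)
        = (1 + \<alpha>) * (1 - 2 * a * real m) * a * R / ?D"
      "a\<^sup>2 * R = a\<^sup>2 * ((1 + \<alpha>) * real m) * R / ?D"
      unfolding D using pos by (simp_all add: power2_eq_square diff_divide_distrib left_diff_distrib)
    then show ?thesis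
      by (simp add: power2_eq_square algebra_simps flip: add_divide_distrib)
  qed
  finally show ?thesis
    by (simp add: w_def R_def)
qed

section \<open>The two-colour Polya distribution\<close>

text \<open>
  The probability of \<open>i\<close> balls of the first and \<open>j\<close> of the second colour among \<open>m\<close> draws, for
  \<open>i + j \<le> m\<close>; also known as the Dirichlet-multinomial distribution when \<open>\<alpha> > 0\<close>.
\<close>

definition polya :: "nat \<Rightarrow> real \<Rightarrow> real \<Rightarrow> real \<Rightarrow> nat \<Rightarrow> nat \<Rightarrow> real" where
  "polya m \<alpha> a b i j =
     fact m / (fact i * fact j * fact (m - i - j)) * stancu_weight m i j a b \<alpha>"

abbreviation index_triangle :: "nat \<Rightarrow> (nat \<times> nat) set" where
  "index_triangle m \<equiv> {(i, j). i + j \<le> m}"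

lemma index_triangle_eq_Sigma: "index_triangle m = Sigma {..m} (\<lambda>i. {..m - i})"
  by auto

lemma polya_nonneg:
  assumes "\<alpha> \<ge> 0" "a \<ge> 0" "b \<ge> 0" "a + b \<le> 1"
  shows "polya m \<alpha> a b i j \<ge> 0"
  using assms rising_nonneg[of \<alpha> a i] rising_nonneg[of \<alpha> b j]
    rising_nonneg[of \<alpha> "1 - a - b" "m - i - j"] rising_nonneg[of \<alpha> 1 m]
  by (simp add: polya_def stancu_weight_def flip: rising_def)

lemma continuous_on_polya:
  assumes "continuous_on S u" and "continuous_on S v"
  shows "continuous_on S (\<lambda>z. polya m \<alpha> (u z) (v z) i j)"
  unfolding polya_def stancu_weight_def divide_inverse
  by (intro continuous_on_mult continuous_on_prod continuous_on_add continuous_on_diff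
      continuous_on_const assms)

lemma polya_swap: "polya m \<alpha> a b i j = polya m \<alpha> b a j i"
proof -
  have "m - i - j = m - j - i" "1 - a - b = 1 - b - a" by simp_all
  then show ?thesis
    unfolding polya_def stancu_weight_def by (simp only: mult_ac)
qed

text \<open>
  Given that the first colour occurs \<open>i\<close> times, the other \<open>m - i\<close> draws come from an urn with the
  two masses \<open>b\<close> and \<open>1 - a - b\<close>. In this form the sum over \<open>j\<close> is a Vandermonde sum.
\<close>

lemma polya_eq_conditional:
  assumes "i + j \<le> m"
  shows "polya m \<alpha> a b i j = real (m choose i) * rising \<alpha> a i / rising \<alpha> 1 m *
    (real (m - i choose j) * rising \<alpha> b j * rising \<alpha> (1 - a - b) (m - i - j))"
proof -
  have "fact m / (fact i * fact j * fact (m - i - j)) = real (m choose i) * real (m - i choose j)"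
    using assms by (simp add: binomial_fact)
  then show ?thesis
    by (simp add: polya_def stancu_weight_def rising_def)
qed

text \<open>
  Merging the other two colours into one of mass \<open>1 - a\<close> leaves the one-colour distribution. Every
  moment needed below involves one colour at a time, so this removes the second index.
\<close>

lemma polya_first_marginal:
  "(\<Sum>(i, j)\<in>index_triangle m. polya m \<alpha> a b i j * \<phi> i)
    = (\<Sum>i\<le>m. real (m choose i) * rising \<alpha> a i * rising \<alpha> (1 - a) (m - i) * \<phi> i) / rising \<alpha> 1 m"
proof -
  have "(\<Sum>(i, j)\<in>index_triangle m. polya m \<alpha> a b i j * \<phi> i)
      = (\<Sum>i\<le>m. \<Sum>j\<le>m - i. polya m \<alpha> a b i j * \<phi> i)"
    unfolding index_triangle_eq_Sigma by (subst sum.Sigma) auto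
  also have "\<dots> = (\<Sum>i\<le>m. real (m choose i) * rising \<alpha> a i / rising \<alpha> 1 m * \<phi> i *
      (\<Sum>j\<le>m - i. real (m - i choose j) * rising \<alpha> b j * rising \<alpha> (1 - a - b) (m - i - j)))"
    unfolding sum_distrib_left
    by (intro sum.cong refl) (simp add: polya_eq_conditional)
  also have "\<dots> = (\<Sum>i\<le>m. real (m choose i) * rising \<alpha> a i / rising \<alpha> 1 m * \<phi> i *
      rising \<alpha> (1 - a) (m - i))"
    unfolding rising_vandermonde by simp
  finally show ?thesis
    by (simp add: sum_divide_distrib mult_ac)
qed

lemma polya_second_marginal:
  "(\<Sum>(i, j)\<in>index_triangle m. polya m \<alpha> a b i j * \<phi> j)
    = (\<Sum>j\<le>m. real (m choose j) * rising \<alpha> b j * rising \<alpha> (1 - b) (m - j) * \<phi> j) / rising \<alpha> 1 m"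
proof -
  have "(\<Sum>(i, j)\<in>index_triangle m. polya m \<alpha> a b i j * \<phi> j)
      = (\<Sum>(j, i)\<in>index_triangle m. polya m \<alpha> b a j i * \<phi> j)"
    by (rule sum.reindex_bij_witness[of _ prod.swap prod.swap])
       (auto simp: polya_swap[of m \<alpha> a b])
  then show ?thesis
    by (simp add: polya_first_marginal)
qed

lemma polya_sum_one:
  assumes "\<alpha> \<ge> 0"
  shows "(\<Sum>(i, j)\<in>index_triangle m. polya m \<alpha> a b i j) = 1"
  using polya_first_marginal[of m \<alpha> a b "\<lambda>_. 1"] rising_vandermonde[of m \<alpha> a "1 - a"]
    rising_pos[OF assms, of 1 m] by simp

lemma polya_dispersion:
  assumes "\<alpha> \<ge> 0" and "m \<ge> 1"
  shows "(\<Sum>(i, j)\<in>index_triangle m.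
      polya m \<alpha> a b i j * ((real i / real m - a)\<^sup>2 + (real j / real m - b)\<^sup>2))
    = (a * (1 - a) + b * (1 - b)) * ((1 + \<alpha> * real m) / (real m + \<alpha> * real m))"
proof -
  have "(\<Sum>(i, j)\<in>index_triangle m.
      polya m \<alpha> a b i j * ((real i / real m - a)\<^sup>2 + (real j / real m - b)\<^sup>2))
    = (\<Sum>(i, j)\<in>index_triangle m. polya m \<alpha> a b i j * (real i / real m - a)\<^sup>2)
      + (\<Sum>(i, j)\<in>index_triangle m. polya m \<alpha> a b i j * (real j / real m - b)\<^sup>2)"
    by (simp add: case_prod_unfold distrib_left sum.distrib)
  then show ?thesis
    unfolding polya_first_marginal polya_second_marginal polya_variance[OF assms] distrib_right
    using rising_pos[OF assms(1), of 1 m] by simp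
qed

section \<open>The pointwise estimate\<close>

text \<open>
  The segment between the two points is cut into \<open>N\<close> equal pieces of length at most \<open>\<delta>\<close>, and the
  oscillations add up to at most \<open>N w\<close>. With \<open>s\<close> the distance in units of \<open>\<delta>\<close>, the number
  \<open>N = \<lceil>s\<rceil> \<le> 1 + s\<close> suffices. The bound is stated with \<open>s\<^sup>2\<close> so that variances can be used; for
  \<open>s > 1\<close> this is weaker than \<open>1 + s\<close>, and for \<open>s \<le> 1\<close> a single piece is enough.
\<close>

lemma modulus_of_continuity_subdivide:
  fixes g :: "real \<Rightarrow> real \<Rightarrow> real"
  assumes \<delta>: "\<delta> > 0" and "w \<ge> 0"
    and osc: "\<And>a b a' b'. {a, b, a', b'} \<subseteq> {0..1} \<Longrightarrow> \<bar>a - a'\<bar> + \<bar>b - b'\<bar> \<le> \<delta>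
      \<Longrightarrow> \<bar>g a' b' - g a b\<bar> \<le> w"
    and in_square: "{a, b, a', b'} \<subseteq> {0..1}"
  shows "\<bar>g a' b' - g a b\<bar> \<le> (1 + ((\<bar>a - a'\<bar> + \<bar>b - b'\<bar>) / \<delta>)\<^sup>2) * w"
proof -
  define s where "s = (\<bar>a - a'\<bar> + \<bar>b - b'\<bar>) / \<delta>"
  have "s \<ge> 0" using \<delta> by (simp add: s_def)
  show ?thesis
  proof (cases "s \<le> 1")
    case True
    then have "\<bar>g a' b' - g a b\<bar> \<le> w"
      using osc[OF in_square] \<delta> by (simp add: s_def)
    also have "\<dots> \<le> (1 + s\<^sup>2) * w"
      using \<open>w \<ge> 0\<close> by (simp add: distrib_right)
    finally show ?thesis by (simp add: s_def)
  next
    case False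
    define N where "N = nat \<lceil>s\<rceil>"
    have N: "s \<le> real N" "real N \<le> 1 + s" "N > 0"
      using False by (auto simp: N_def) linarith+
    define p where "p = (\<lambda>k. a + real k / real N * (a' - a))"
    define q where "q = (\<lambda>k. b + real k / real N * (b' - b))"
    have inside: "c + r * (c' - c) \<in> {0..1}"
      if "c \<in> {0..1}" "c' \<in> {0..1}" "r \<in> {0..1}" for c c' r :: real
    proof -
      have "c + r * (c' - c) = (1 - r) * c + r * c'" by (simp add: algebra_simps)
      then show ?thesis
        using that convexD[of "{0..1::real}" c c' "1 - r" r] by auto
    qed
    have step: "\<bar>g (p (Suc k)) (q (Suc k)) - g (p k) (q k)\<bar> \<le> w" if "k < N" for k
    proof (rule osc)
      have "real k / real N \<in> {0..1}" "real (Suc k) / real N \<in> {0..1}"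
        using that by auto
      then show "{p k, q k, p (Suc k), q (Suc k)} \<subseteq> {0..1}"
        using in_square unfolding p_def q_def insert_subset by (intro conjI inside) auto
      have "p k - p (Suc k) = (a - a') / real N" "q k - q (Suc k) = (b - b') / real N"
        using N by (auto simp: p_def q_def field_simps)
      then have "\<bar>p k - p (Suc k)\<bar> + \<bar>q k - q (Suc k)\<bar> = s * \<delta> / real N"
        using \<delta> N by (simp add: s_def abs_divide flip: add_divide_distrib)
      also have "\<dots> \<le> \<delta>"
        using N \<delta> by (simp add: divide_le_eq mult.commute)
      finally show "\<bar>p k - p (Suc k)\<bar> + \<bar>q k - q (Suc k)\<bar> \<le> \<delta>" .
    qed
    have "g a' b' - g a b = (\<Sum>k<N. g (p (Suc k)) (q (Suc k)) - g (p k) (q k))"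
      using N by (subst sum_lessThan_telescope) (simp add: p_def q_def)
    also have "\<bar>\<dots>\<bar> \<le> (\<Sum>k<N. w)"
      using step by (intro order.trans[OF sum_abs] sum_mono) auto
    also have "\<dots> \<le> (1 + s) * w"
      using N \<open>w \<ge> 0\<close> by (simp add: mult_right_mono)
    also have "\<dots> \<le> (1 + s\<^sup>2) * w"
      using False \<open>w \<ge> 0\<close> by (intro mult_right_mono) (auto simp: power2_eq_square)
    finally show ?thesis by (simp add: s_def)
  qed
qed

text \<open>
  The error is the expectation of \<open>g a b - g (i/m) (j/m)\<close>, because the weights have sum 1. The
  quadratic bound on the increments of \<open>g\<close> turns it into an expectation of squared deviations.
  The choice of \<open>\<delta>\<close> cancels the common factor of the two variances and leaves
  \<open>w (1 + 2 (a (1 - a) + b (1 - b)))\<close>, which is at most \<open>2 w\<close>.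
\<close>

lemma bivariate_stancu_error:
  fixes g :: "real \<Rightarrow> real \<Rightarrow> real"
  assumes "\<alpha> \<ge> 0" "m \<ge> 1" "a \<ge> 0" "b \<ge> 0" "a + b \<le> 1" "w \<ge> 0"
    and \<delta>_def: "\<delta> = sqrt ((1 + \<alpha> * real m) / (real m + \<alpha> * real m))"
    and osc: "\<And>a b a' b'. {a, b, a', b'} \<subseteq> {0..1} \<Longrightarrow> \<bar>a - a'\<bar> + \<bar>b - b'\<bar> \<le> \<delta>
      \<Longrightarrow> \<bar>g a' b' - g a b\<bar> \<le> w"
  shows "\<bar>g a b - (\<Sum>(i, j)\<in>index_triangle m. polya m \<alpha> a b i j * g (real i / real m) (real j / real m))\<bar>
    \<le> 2 * w"
proof -
  let ?p = "polya m \<alpha> a b"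
  let ?E = "\<Sum>(i, j)\<in>index_triangle m. ?p i j * (g a b - g (real i / real m) (real j / real m))"
  let ?d = "\<lambda>i j. (real i / real m - a)\<^sup>2 + (real j / real m - b)\<^sup>2"
  have "real m > 0" "\<alpha> * real m \<ge> 0" using assms by auto
  then have ratio: "(1 + \<alpha> * real m) / (real m + \<alpha> * real m) > 0"
    by (intro divide_pos_pos add_pos_nonneg) auto
  then have \<delta>: "\<delta> > 0" "\<delta>\<^sup>2 = (1 + \<alpha> * real m) / (real m + \<alpha> * real m)"
    by (auto simp: \<delta>_def)
  have sum_one: "(\<Sum>(i, j)\<in>index_triangle m. ?p i j) = 1"
    by (rule polya_sum_one) fact
  have node: "\<bar>g a b - g (real i / real m) (real j / real m)\<bar> \<le> (1 + 2 / \<delta>\<^sup>2 * ?d i j) * w"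
    if "i + j \<le> m" for i j
  proof -
    let ?u = "\<bar>real i / real m - a\<bar>" and ?v = "\<bar>real j / real m - b\<bar>"
    have "{real i / real m, real j / real m, a, b} \<subseteq> {0..1}"
      using that assms by auto
    then have "\<bar>g a b - g (real i / real m) (real j / real m)\<bar> \<le> (1 + ((?u + ?v) / \<delta>)\<^sup>2) * w"
      using modulus_of_continuity_subdivide[of \<delta> w g] \<delta> \<open>w \<ge> 0\<close> osc by blast
    also have "(?u + ?v)\<^sup>2 \<le> 2 * ?d i j"
      using sum_squares_bound[of ?u ?v] by (simp add: power2_sum)
    then have "((?u + ?v) / \<delta>)\<^sup>2 \<le> 2 / \<delta>\<^sup>2 * ?d i j"
      using \<delta>(1) by (simp add: power_divide divide_right_mono)
    then have "(1 + ((?u + ?v) / \<delta>)\<^sup>2) * w \<le> (1 + 2 / \<delta>\<^sup>2 * ?d i j) * w"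
      using \<open>w \<ge> 0\<close> by (intro mult_right_mono) auto
    finally show ?thesis .
  qed
  have p_nonneg: "?p i j \<ge> 0" for i j
    by (rule polya_nonneg) fact+
  have quarter: "c * (1 - c) \<le> 1 / 4" for c :: real
    using zero_le_power2[of "c - 1 / 2"] by (simp add: power2_eq_square algebra_simps)
  have "g a b - (\<Sum>(i, j)\<in>index_triangle m. ?p i j * g (real i / real m) (real j / real m))
      = (\<Sum>(i, j)\<in>index_triangle m. ?p i j) * g a b
        - (\<Sum>(i, j)\<in>index_triangle m. ?p i j * g (real i / real m) (real j / real m))"
    by (simp add: sum_one)
  also have "\<dots> = ?E"
    by (simp add: sum_distrib_right sum_subtractf case_prod_unfold right_diff_distrib)
  finally have error: "g a b - (\<Sum>(i, j)\<in>index_triangle m. ?p i j * g (real i / real m) (real j / real m)) = ?E" .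
  have "\<bar>?E\<bar> \<le> (\<Sum>(i, j)\<in>index_triangle m. ?p i j * ((1 + 2 / \<delta>\<^sup>2 * ?d i j) * w))"
  proof (intro order.trans[OF sum_abs] sum_mono, clarify)
    fix i j assume "i + j \<le> m"
    from mult_left_mono[OF node[OF this] p_nonneg]
    show "\<bar>?p i j * (g a b - g (real i / real m) (real j / real m))\<bar>
        \<le> ?p i j * ((1 + 2 / \<delta>\<^sup>2 * ?d i j) * w)"
      by (simp only: abs_mult abs_of_nonneg[OF p_nonneg])
  qed
  also have "\<dots> = w * ((\<Sum>(i, j)\<in>index_triangle m. ?p i j)
      + 2 / \<delta>\<^sup>2 * (\<Sum>(i, j)\<in>index_triangle m. ?p i j * ?d i j))"
  proof -
    have "p * ((1 + c * d) * w) = w * (p + c * (p * d))" for p c d :: real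
      by (simp add: algebra_simps)
    then show ?thesis
      by (simp only: case_prod_unfold sum.distrib flip: sum_distrib_left)
  qed
  also have "\<dots> = w * (1 + 2 * (a * (1 - a) + b * (1 - b)))"
    unfolding sum_one polya_dispersion[OF assms(1,2)] \<delta>(2)[symmetric] using \<delta>(1) by simp
  also have "\<dots> \<le> w * 2"
    using quarter[of a] quarter[of b] \<open>w \<ge> 0\<close> by (intro mult_left_mono) auto
  finally show ?thesis by (simp only: error mult.commute)
qed

section \<open>The modulus of continuity of a continuous kernel\<close>

abbreviation unit_cube5 :: "(real \<times> real \<times> real \<times> real \<times> real) set" where
  "unit_cube5 \<equiv> {0..1} \<times> {0..1} \<times> {0..1} \<times> {0..1} \<times> {0..1}"

text \<open>
  Continuity on the compact cube is what gives the two nested suprema their meaning: it bounds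
  \<open>f\<close>, hence all differences, and so both suprema are upper bounds of the values they range over.
\<close>

lemma kernel_modulus_upper:
  assumes cont: "continuous_on unit_cube5 f"
    and "{t, z1, z2, a, b, a', b'} \<subseteq> {0..1}" and "\<bar>a - a'\<bar> + \<bar>b - b'\<bar> \<le> \<delta>"
  shows "\<bar>f (t, z1, z2, a', b') - f (t, z1, z2, a, b)\<bar> \<le> kernel_modulus f \<delta>"
proof -
  define D where "D = {((x', y'), (x'', y'')). (x', y') \<in> {0..1::real} \<times> {0..1::real} \<and>
    (x'', y'') \<in> {0..1} \<times> {0..1} \<and> \<bar>x' - x''\<bar> + \<bar>y' - y''\<bar> \<le> \<delta>}"
  define h where "h = (\<lambda>(t, z1, z2). \<lambda>((x', y'), (x'', y'')).
    \<bar>f (t, z1, z2, x'', y'') - f (t, z1, z2, x', y')\<bar>)"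
  have modulus: "kernel_modulus f \<delta> = (SUP p\<in>{0..1} \<times> {0..1} \<times> {0..1}. SUP q\<in>D. h p q)"
    unfolding kernel_modulus_def D_def h_def by (simp add: case_prod_unfold)
  have "compact (f ` unit_cube5)"
    by (intro compact_continuous_image cont compact_Times compact_Icc)
  then obtain B where B: "\<And>v. v \<in> unit_cube5 \<Longrightarrow> \<bar>f v\<bar> \<le> B"
    using compact_imp_bounded[of "f ` unit_cube5"] by (auto simp only: bounded_iff real_norm_def ball_simps)
  have h_le: "h p q \<le> 2 * B" if "p \<in> {0..1} \<times> {0..1} \<times> {0..1}" "q \<in> D" for p q
  proof -
    obtain t z1 z2 x' y' x'' y'' where pq: "p = (t, z1, z2)" "q = ((x', y'), (x'', y''))"
      by (metis surj_pair)
    have "\<bar>f (t, z1, z2, x'', y'')\<bar> \<le> B" "\<bar>f (t, z1, z2, x', y')\<bar> \<le> B"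
      using that by (auto simp: pq D_def intro!: B)
    then show ?thesis by (simp add: pq h_def)
  qed
  have in_D: "((a, b), (a', b')) \<in> D"
    using assms by (simp add: D_def)
  have in_cube: "(t, z1, z2) \<in> {0..1} \<times> {0..1} \<times> {0..1}"
    using assms by simp
  have "h (t, z1, z2) ((a, b), (a', b')) \<le> (SUP q\<in>D. h (t, z1, z2) q)"
    using h_le[OF in_cube] in_D by (intro cSUP_upper bdd_aboveI2[where M = "2 * B"])
  also have "\<dots> \<le> (SUP p\<in>{0..1} \<times> {0..1} \<times> {0..1}. SUP q\<in>D. h p q)"
    using h_le in_D in_cube
    by (intro cSUP_upper bdd_aboveI2[where M = "2 * B"] cSUP_least) auto
  finally show ?thesis
    by (simp add: modulus h_def)
qed

section \<open>Integration over the simplex\<close>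

lemma simplex2_subset_unit_square: "simplex2 \<subseteq> cbox (0, 0) (1, 1)"
  by (auto simp: simplex2_def)

lemma compact_simplex2: "compact simplex2"
proof -
  have "simplex2 = {z. fst z \<ge> 0} \<inter> {z. snd z \<ge> 0} \<inter> {z. fst z + snd z \<le> 1}"
    by (auto simp: simplex2_def)
  also have "closed \<dots>"
    by (intro closed_Int closed_Collect_le continuous_intros)
  finally show ?thesis
    using bounded_subset[OF bounded_cbox simplex2_subset_unit_square] compact_eq_bounded_closed
    by blast
qed

lemma integrable_on_simplex2:
  fixes g :: "real \<times> real \<Rightarrow> real"
  assumes "continuous_on simplex2 g"
  shows "g integrable_on simplex2"
proof -
  have "set_integrable lborel simplex2 g"
    unfolding set_integrable_def by (rule borel_integrable_compact[OF compact_simplex2 assms])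
  then show ?thesis
    by (rule set_borel_integral_eq_integral(1))
qed

text \<open>
  The integrand is extended by 0 to the unit square, whose area 1 then replaces the area of the
  simplex.
\<close>

lemma integral_simplex2_bound:
  fixes g :: "real \<times> real \<Rightarrow> real"
  assumes "g integrable_on simplex2" and "B \<ge> 0" and "\<And>z. z \<in> simplex2 \<Longrightarrow> \<bar>g z\<bar> \<le> B"
  shows "\<bar>integral simplex2 g\<bar> \<le> B"
proof -
  have "((\<lambda>z. if z \<in> simplex2 then g z else 0) has_integral integral simplex2 g) (cbox (0, 0) (1, 1))"
    using assms(1) simplex2_subset_unit_square by (simp add: has_integral_restrict integrable_integral)
  from has_integral_bound[OF assms(2) this] assms(2,3)
  show ?thesis by (simp add: content_Pair)
qed

theorem theorem6:
  fixes f :: "real \<times> real \<times> real \<times> real \<times> real \<Rightarrow> real"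
    and \<alpha> t :: real and m :: nat and x y :: "real \<Rightarrow> real"
  assumes "continuous_on ({0..1} \<times> {0..1} \<times> {0..1} \<times> {0..1} \<times> {0..1}) f"
    and "\<alpha> \<ge> 0" and "m \<ge> 1" and "t \<in> {0..1}" and "(x, y) \<in> admissible_pairs"
  shows "\<bar>urison f t x y - operator_polynomial m \<alpha> f t x y\<bar>
    \<le> 2 * kernel_modulus f (sqrt ((1 + \<alpha> * real m) / (real m + \<alpha> * real m)))"
proof -
  define \<delta> where "\<delta> = sqrt ((1 + \<alpha> * real m) / (real m + \<alpha> * real m))"
  define w where "w = kernel_modulus f \<delta>"
  define U where "U = (\<lambda>z. f (t, fst z, snd z, x (fst z), y (snd z)))"
  define P where "P = (\<lambda>z. \<Sum>(i, j)\<in>index_triangle m. polya m \<alpha> (x (fst z)) (y (snd z)) i j *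
    f (t, fst z, snd z, real i / real m, real j / real m))"
  have simplexD: "fst z \<in> {0..1}" "snd z \<in> {0..1}"
    "x (fst z) \<ge> 0" "y (snd z) \<ge> 0" "x (fst z) + y (snd z) \<le> 1" if "z \<in> simplex2" for z
    using that assms(5) by (auto simp: simplex2_def admissible_pairs_def)
  have osc: "\<bar>f (t, z1, z2, a', b') - f (t, z1, z2, a, b)\<bar> \<le> w"
    if "{z1, z2} \<subseteq> {0..1}" "{a, b, a', b'} \<subseteq> {0..1}" "\<bar>a - a'\<bar> + \<bar>b - b'\<bar> \<le> \<delta>" for z1 z2 a b a' b'
    unfolding w_def using that assms(4) by (intro kernel_modulus_upper[OF assms(1)]) auto
  have "\<delta> \<ge> 0" using assms by (simp add: \<delta>_def)
  \<comment> \<open>The oscillation between a point and itself is 0, and \<open>w\<close> bounds it.\<close>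
  then have "w \<ge> 0"
    using osc[of 0 0 0 0 0 0] by simp
  have "continuous_on {0..1} x" "continuous_on {0..1} y"
    using assms(5) by (auto simp: admissible_pairs_def)
  then have cont_x: "continuous_on simplex2 (\<lambda>z. x (fst z))"
    and cont_y: "continuous_on simplex2 (\<lambda>z. y (snd z))"
    using simplexD(1,2) continuous_on_compose2[of "{0..1}" x simplex2 fst]
      continuous_on_compose2[of "{0..1}" y simplex2 snd]
    by (simp_all add: image_subset_iff continuous_on_fst continuous_on_snd continuous_on_id)
  have cont_f: "continuous_on simplex2 (\<lambda>z. f (t, fst z, snd z, a z, b z))"
    if "continuous_on simplex2 a" "continuous_on simplex2 b"
      "\<And>z. z \<in> simplex2 \<Longrightarrow> a z \<in> {0..1} \<and> b z \<in> {0..1}" for a b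
    by (rule continuous_on_compose2[OF assms(1)], intro continuous_intros that)
       (use that(3) simplexD(1,2) assms(4) in auto)
  have "continuous_on simplex2 U"
    unfolding U_def
  proof (rule cont_f[OF cont_x cont_y])
    show "x (fst z) \<in> {0..1} \<and> y (snd z) \<in> {0..1}" if "z \<in> simplex2" for z
      using simplexD(3-5)[OF that] by simp
  qed
  then have int_U: "U integrable_on simplex2" by (rule integrable_on_simplex2)
  have "continuous_on simplex2 (\<lambda>z. polya m \<alpha> (x (fst z)) (y (snd z)) i j *
      f (t, fst z, snd z, real i / real m, real j / real m))" if "i + j \<le> m" for i j
    by (intro continuous_on_mult continuous_on_polya cont_x cont_y cont_f continuous_on_const)
       (use that assms(3) in auto)
  then have "continuous_on simplex2 P"
    unfolding P_def case_prod_unfold by (intro continuous_on_sum) auto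
  then have int_P: "P integrable_on simplex2" by (rule integrable_on_simplex2)
  have "urison f t x y = integral simplex2 U"
    "operator_polynomial m \<alpha> f t x y = integral simplex2 P"
    by (simp_all add: urison_def operator_polynomial_def U_def P_def polya_def case_prod_unfold)
  then have "urison f t x y - operator_polynomial m \<alpha> f t x y = integral simplex2 (\<lambda>z. U z - P z)"
    using integral_diff[OF int_U int_P] by simp
  also have "\<bar>\<dots>\<bar> \<le> 2 * w"
  proof (rule integral_simplex2_bound)
    show "(\<lambda>z. U z - P z) integrable_on simplex2"
      by (rule integrable_diff[OF int_U int_P])
    show "2 * w \<ge> 0" using \<open>w \<ge> 0\<close> by simp
    fix z assume z: "z \<in> simplex2"
    show "\<bar>U z - P z\<bar> \<le> 2 * w"
      unfolding U_def P_def
      using bivariate_stancu_error[OF assms(2,3) simplexD(3-5)[OF z] \<open>w \<ge> 0\<close> \<delta>_def,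
          of "\<lambda>a b. f (t, fst z, snd z, a, b)"] osc[of "fst z" "snd z"] simplexD(1,2)[OF z]
      by simp
  qed
  finally show ?thesis by (simp add: w_def \<delta>_def)
qed

end
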